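(* For any given natural number $k$, and all $1 \le i \le k$, let $p(i)$ denote the $i$-th prime, and define the sequence $\{a_P(i) : i = 1 \text{ to } k\}$ of integers such that $0 \le a_P(i) < p(i)$ and $$p(k) + a_P(i) \equiv 0 \pmod{p(i)}.$$ Let $d_P(k)$ be a natural number such that, for all natural numbers $l < d_P(k)$, there is some $i$ with $1 \le i \le k$ such that $$l \equiv a_P(i) \pmod{p(i)}.$$ Then $d_P(k)$ is the Prime Difference, defined by $$p(k+1) - p(k) = d_P(k).$$
   Context: $p(i)$ denotes the $i$-th prime number, with $p(1) = 2$, $p(2) = 3$, and so on. The letters $i$, $k$, $l$ represent natural numbers. The Prime Difference at $k$ is the difference $p(k+1) - p(k)$ between consecutive primes.
   Formalization: d_P(k) is taken to be the largest natural number such that every l < d_P(k) satisfies some congruence l ≡ a_P(i) mod p(i); without maximality the claim is false (k = 2, d = 1 meets the condition, but p(3) - p(2) = 2). *)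

theory Defs
  imports "HOL-Library.Infinite_Set" "HOL-Number_Theory.Cong"
begin

text \<open>
  The sequence of primes is indexed from 1, as in \<open>p(1) = 2\<close>, \<open>p(2) = 3\<close>, whereas
  \<^const>\<open>enumerate\<close> counts from 0. The value at 0 has no meaning.
\<close>
definition nth_prime :: "nat \<Rightarrow> nat" where
  "nth_prime i = enumerate {q. prime q} (i - 1)"

text \<open>
  Every natural number \<open>l < d\<close> lies in one of the residue classes \<open>a i\<close> modulo the
  \<open>i\<close>-th prime, \<open>1 \<le> i \<le> k\<close>. This property is inherited by all smaller \<open>d\<close>, so it
  determines a unique number only as the largest one with the property.
\<close>
definition covered_below :: "(nat \<Rightarrow> int) \<Rightarrow> nat \<Rightarrow> nat \<Rightarrow> bool" where
  "covered_below a k d \<longleftrightarrow>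
     (\<forall>l<d. \<exists>i. 1 \<le> i \<and> i \<le> k \<and> [int l = a i] (mod int (nth_prime i)))"

end

theory Submission
  imports Defs
begin

text \<open>
  Since \<open>a i \<equiv> - p(k)\<close> modulo \<open>p(i)\<close>, the number \<open>l\<close> lies in the class of \<open>a i\<close> exactly if
  \<open>p(i)\<close> divides \<open>p(k) + l\<close>. Every number in \<open>{p(k)..<p(k+1)}\<close> has a prime factor below
  \<open>p(k+1)\<close>, hence among \<open>p(1), \<dots>, p(k)\<close>, while \<open>p(k+1)\<close> has none. So the first uncovered \<open>l\<close>
  is \<open>p(k+1) - p(k)\<close>.
\<close>

lemma prime_nth_prime: "prime (nth_prime i)"
  using enumerate_in_set[OF primes_infinite] by (simp add: nth_prime_def)

text \<open>Truncated subtraction in \<open>i - 1\<close> makes the indices 0 and 1 name the same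
  prime, hence the lower bounds.\<close>

lemma nth_prime_less_iff:
  assumes "1 \<le> i" "1 \<le> j"
  shows "nth_prime i < nth_prime j \<longleftrightarrow> i < j"
  using assms strict_mono_less[OF strict_mono_enumerate[OF primes_infinite], of "i - 1" "j - 1"]
  by (auto simp: nth_prime_def)

lemma prime_eq_nth_prime:
  assumes "prime q"
  obtains i where "1 \<le> i" "nth_prime i = q"
proof -
  obtain n where "enumerate {q. prime q} n = q"
    using enumerate_Ex[of "{q. prime q}" q] primes_infinite assms by auto
  then have "nth_prime (Suc n) = q"
    by (simp add: nth_prime_def)
  then show thesis
    by (intro that[of "Suc n"]) auto
qed

lemma ex_nth_prime_dvd:
  assumes "2 \<le> m" "m < nth_prime (k + 1)"
  shows "\<exists>i. 1 \<le> i \<and> i \<le> k \<and> nth_prime i dvd m"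
proof -
  obtain q where q: "prime q" "q dvd m"
    using prime_factor_nat[of m] assms(1) by auto
  obtain i where i: "1 \<le> i" "nth_prime i = q"
    using prime_eq_nth_prime[OF q(1)] .
  have "q < nth_prime (k + 1)"
    using dvd_imp_le[OF q(2)] assms by linarith
  then have "i \<le> k"
    using nth_prime_less_iff[of i "k + 1"] i by simp
  then show ?thesis
    using i q(2) by blast
qed

text \<open>A prime dividing a prime equals it, but primes with different positive indices
  differ.\<close>

lemma not_nth_prime_dvd_Suc:
  assumes "1 \<le> i" "i \<le> k"
  shows "\<not> nth_prime i dvd nth_prime (k + 1)"
  using primes_dvd_imp_eq[OF prime_nth_prime prime_nth_prime, of i "k + 1"]
    nth_prime_less_iff[of i "k + 1"] assms by auto

text \<open>Adding \<open>q\<close> to both sides turns \<open>a\<close> into 0 modulo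
  \<open>p\<close>.\<close>

lemma cong_iff_dvd_add:
  fixes p q l :: nat and a :: int
  assumes "[int q + a = 0] (mod int p)"
  shows "[int l = a] (mod int p) \<longleftrightarrow> p dvd q + l"
proof -
  have "[int l = a] (mod int p) \<longleftrightarrow> [int q + int l = int q + a] (mod int p)"
    by (simp add: cong_add_lcancel)
  also have "\<dots> \<longleftrightarrow> [int q + int l = 0] (mod int p)"
    using assms by (meson cong_sym cong_trans)
  also have "\<dots> \<longleftrightarrow> p dvd q + l"
    by (simp add: cong_0_iff flip: of_nat_add)
  finally show ?thesis .
qed

text \<open>Describing all covered \<open>n\<close> as an initial segment shows that a largest one
  exists, so \<open>GREATEST\<close> can be evaluated.\<close>

lemma covered_below_iff:
  assumes "1 \<le> k"
    and "\<And>i. 1 \<le> i \<Longrightarrow> i \<le> k \<Longrightarrow> [int (nth_prime k) + a i = 0] (mod int (nth_prime i))"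
  shows "covered_below a k n \<longleftrightarrow> n \<le> nth_prime (k + 1) - nth_prime k"
proof -
  have less: "nth_prime k < nth_prime (k + 1)"
    using nth_prime_less_iff[of k "k + 1"] assms(1) by simp
  have covered: "covered_below a k n \<longleftrightarrow>
      (\<forall>l<n. \<exists>i. 1 \<le> i \<and> i \<le> k \<and> nth_prime i dvd nth_prime k + l)"
    unfolding covered_below_def using cong_iff_dvd_add[OF assms(2)] by blast
  show ?thesis
  proof
    assume "covered_below a k n"
    show "n \<le> nth_prime (k + 1) - nth_prime k"
    proof (rule ccontr)
      assume "\<not> ?thesis"
      \<comment> \<open>The witness is l = p(k+1) - p(k), which is below \<open>n\<close> by the
        negated claim; then p(k) + l is p(k+1) itself.\<close>
      then obtain i where "1 \<le> i" "i \<le> k"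
        "nth_prime i dvd nth_prime k + (nth_prime (k + 1) - nth_prime k)"
        using \<open>covered_below a k n\<close> covered by (meson not_le)
      then show False
        using not_nth_prime_dvd_Suc less by simp
    qed
  next
    assume "n \<le> nth_prime (k + 1) - nth_prime k"
    \<comment> \<open>For l < n, the number p(k) + l is at least p(k) \<ge> 2 and below p(k+1), as
      \<open>ex_nth_prime_dvd\<close> demands.\<close>
    then show "covered_below a k n"
      unfolding covered using prime_ge_2_nat[OF prime_nth_prime[of k]]
      by (intro allI impI ex_nth_prime_dvd) linarith+
  qed
qed

theorem theorem1p1:
  fixes k d :: nat and a :: "nat \<Rightarrow> int"
  assumes "1 \<le> k"
    and "\<And>i. 1 \<le> i \<Longrightarrow> i \<le> k \<Longrightarrow> 0 \<le> a i \<and> a i < int (nth_prime i)"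
    and "\<And>i. 1 \<le> i \<Longrightarrow> i \<le> k \<Longrightarrow> [int (nth_prime k) + a i = 0] (mod int (nth_prime i))"
    and "d = (GREATEST n. covered_below a k n)"
  shows "int (nth_prime (k + 1)) - int (nth_prime k) = int d"
proof -
  have "covered_below a k n \<longleftrightarrow> n \<le> nth_prime (k + 1) - nth_prime k" for n
    using assms(1,3) by (rule covered_below_iff)
  then have "d = nth_prime (k + 1) - nth_prime k"
    unfolding assms(4) by (intro Greatest_equality) auto
  \<comment> \<open>Since p(k) < p(k+1), the natural subtraction does not truncate and agrees with
    the integer one.\<close>
  then show ?thesis
    using nth_prime_less_iff[of k "k + 1"] assms(1) by simp
qed

end
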